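(* For each positive integer $n$, let $P_n$ be the Markov transition kernel on $\mathbb R^n$ (with its Borel $\sigma$-algebra) given by \[ P_n(x,\mathrm dy)\propto\exp\Big(-\tfrac23\big\|y-\tfrac x2\big\|^2\Big)\,\mathrm dy,\qquad x\in\mathbb R^n, \] where $\|\cdot\|$ is the Euclidean norm. Then $\rho^*_{\mathrm{opt}}(P_n)\to1$ as $n\to\infty$.
   Context: An Mtk (Markov transition kernel) is a Markov transition kernel $P:\mathsf X\times\mathcal B\to[0,1]$ on a countably generated measurable space $(\mathsf X,\mathcal B)$. Write $Pf(x)=\int_{\mathsf X}P(x,\mathrm dy)f(y)$, $P^m$ for the $m$-step kernel, and $\delta_xP^m=P^m(x,\cdot)$. Total variation distance: $d_{\mathrm{TV}}(\mu,\nu)=\sup_{A\in\mathcal B}[\mu(A)-\nu(A)]$. If $P$ has stationary probability measure $\Pi$, its convergence rate is \[ \rho_*(P)=\exp\Big[\sup_{x\in\mathsf X}\limsup_{m\to\infty}\frac{\log d_{\mathrm{TV}}(\delta_xP^m,\Pi)}{m}\Big]\in[0,1] \] (with $\log 0=-\infty$, $\exp(-\infty)=0$). Let $T_0=[0,1)\times[1,\infty)\times(0,1]\times(0,1]$. $P$ satisfies (A1)-(A3) with parameter $(\lambda,K,\varepsilon,\beta)\in T_0$ if there are $C\in\mathcal B$, a measurable $V:\mathsf X\to[1,\infty)$ and a probability measure $\nu$ on $\mathcal B$ such that: (A1) $PV(x)\le\lambda V(x)1_{\mathsf X\setminus C}(x)+K1_C(x)$ for all $x\in\mathsf X$; (A2)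 $P(x,A)\ge\varepsilon\nu(A)$ for all $x\in C$, $A\in\mathcal B$; (A3) $\nu(C)\ge\beta$. It is known that (A1)-(A3) imply that $P$ has a unique stationary distribution $\Pi$ and $\rho_*(P)<1$. Let $T(P)\subset T_0$ be the set of all parameters with which $P$ satisfies (A1)-(A3). $P$ is reversible if $\int g\,Pf\,\mathrm d\Pi=\int f\,Pg\,\mathrm d\Pi$ for all $f,g\in L^2(\Pi)$, and non-negative definite if $\int f\,Pf\,\mathrm d\Pi\ge0$ for all $f\in L^2(\Pi)$. $S^{(N)}_{\lambda,K,\varepsilon,\beta}$ is the collection of all reversible and non-negative definite Mtks (on varying state spaces) satisfying (A1)-(A3) with parameter $(\lambda,K,\varepsilon,\beta)$. (For set-theoretic reasons, the state spaces are taken from some fixed set of measurable spaces, which includes at least all finite sets of integers.) Let $\rho^{(N)}_{\mathrm{opt}}(\lambda,K,\varepsilon,\beta)=\sup_{Q\in S^{(N)}_{\lambda,K,\varepsilon,\beta}}\rho_*(Q)$. For a reversible and non-negative definite Mtk $P$, the chain-specific optimal bound is $\rho^*_{\mathrm{opt}}(P)=\inf_{(\lambda,K,\varepsilon,\beta)\in T(P)}\rho^{(N)}_{\mathrm{opt}}(\lambda,K,\varepsilon,\beta)$, set equal to $1$ if $T(P)=\emptyset$. The kernel $P_n$ has the $n$-dimensional standard Gaussian distribution as its unique stationary distribution, and it is reversible and non-negative definite, so this definition applies to $P_n$. *)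

theory Defs
  imports "HOL-Probability.Probability"
begin

subsection \<open>Markov transition kernels\<close>

definition countably_generated_space :: "'a measure \<Rightarrow> bool" where
  "countably_generated_space M \<longleftrightarrow>
     (\<exists>G. countable G \<and> G \<subseteq> Pow (space M) \<and> sets M = sigma_sets (space M) G)"

text \<open>
  A measurable space is given by a measure \<open>M\<close> of which only \<open>space M\<close> and \<open>sets M\<close> are used.
  A kernel \<open>P\<close> assigns to each point of \<open>space M\<close> a probability measure on \<open>sets M\<close>.
\<close>

definition markov_kernel :: "'a measure \<Rightarrow> ('a \<Rightarrow> 'a measure) \<Rightarrow> bool" where
  "markov_kernel M P \<longleftrightarrow> countably_generated_space M \<and> P \<in> measurable M (prob_algebra M)"

primrec kernel_power :: "'a measure \<Rightarrow> ('a \<Rightarrow> 'a measure) \<Rightarrow> nat \<Rightarrow> 'a \<Rightarrow> 'a measure" where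
  "kernel_power M P 0 x = return M x"
| "kernel_power M P (Suc m) x = kernel_power M P m x \<bind> P"

definition stationary_distribution ::
    "'a measure \<Rightarrow> ('a \<Rightarrow> 'a measure) \<Rightarrow> 'a measure \<Rightarrow> bool" where
  "stationary_distribution M P \<pi> \<longleftrightarrow> \<pi> \<in> space (prob_algebra M) \<and> \<pi> \<bind> P = \<pi>"

definition square_integrable :: "'a measure \<Rightarrow> ('a \<Rightarrow> real) \<Rightarrow> bool" where
  "square_integrable \<pi> f \<longleftrightarrow> f \<in> borel_measurable \<pi> \<and> integrable \<pi> (\<lambda>x. (f x)\<^sup>2)"

definition reversible_kernel :: "('a \<Rightarrow> 'a measure) \<Rightarrow> 'a measure \<Rightarrow> bool" where
  "reversible_kernel P \<pi> \<longleftrightarrow>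
     (\<forall>f g. square_integrable \<pi> f \<longrightarrow> square_integrable \<pi> g \<longrightarrow>
        (\<integral>x. g x * (\<integral>y. f y \<partial>P x) \<partial>\<pi>) = (\<integral>x. f x * (\<integral>y. g y \<partial>P x) \<partial>\<pi>))"

definition nonneg_definite_kernel :: "('a \<Rightarrow> 'a measure) \<Rightarrow> 'a measure \<Rightarrow> bool" where
  "nonneg_definite_kernel P \<pi> \<longleftrightarrow>
     (\<forall>f. square_integrable \<pi> f \<longrightarrow> 0 \<le> (\<integral>x. f x * (\<integral>y. f y \<partial>P x) \<partial>\<pi>))"

subsection \<open>Convergence rate\<close>

definition tv_dist :: "'a measure \<Rightarrow> 'a measure \<Rightarrow> 'a measure \<Rightarrow> real" where
  "tv_dist M \<mu> \<nu> = (SUP A\<in>sets M. measure \<mu> A - measure \<nu> A)"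

definition log_ext :: "real \<Rightarrow> ereal" where
  "log_ext t = (if t \<le> 0 then -\<infinity> else ereal (ln t))"

definition exp_ext :: "ereal \<Rightarrow> ereal" where
  "exp_ext t = (if t = -\<infinity> then 0 else if t = \<infinity> then \<infinity> else ereal (exp (real_of_ereal t)))"

definition conv_rate :: "'a measure \<Rightarrow> ('a \<Rightarrow> 'a measure) \<Rightarrow> 'a measure \<Rightarrow> ereal" where
  "conv_rate M P \<pi> =
     exp_ext (SUP x\<in>space M.
       limsup (\<lambda>m. log_ext (tv_dist M (kernel_power M P m x) \<pi>) / ereal (real m)))"

subsection \<open>Drift and minorization\<close>

type_synonym dm_param = "real \<times> real \<times> real \<times> real"

definition dm_params :: "dm_param set" where
  "dm_params = {0..<1} \<times> {1..} \<times> {0<..1} \<times> {0<..1}"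

text \<open>
  The drift inequality uses the Lebesgue integral with values in \<open>[0, \<infinity>]\<close>, so that it entails
  finiteness of \<open>P V\<close>; the Bochner integral would be \<open>0\<close> for a non-integrable \<open>V\<close>.
\<close>

fun satisfies_dm :: "'a measure \<Rightarrow> ('a \<Rightarrow> 'a measure) \<Rightarrow> dm_param \<Rightarrow> bool" where
  "satisfies_dm M P (l, K, \<epsilon>, \<beta>) \<longleftrightarrow>
     (\<exists>C V \<nu>. C \<in> sets M \<and> V \<in> borel_measurable M \<and> (\<forall>x\<in>space M. (1::real) \<le> V x) \<and>
        \<nu> \<in> space (prob_algebra M) \<and>
        (\<forall>x\<in>space M. (\<integral>\<^sup>+y. ennreal (V y) \<partial>P x)
            \<le> ennreal (l * V x * indicator (space M - C) x + K * indicator C x)) \<and>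
        (\<forall>x\<in>C. \<forall>A\<in>sets M. measure (P x) A \<ge> \<epsilon> * measure \<nu> A) \<and>
        measure \<nu> C \<ge> \<beta>)"

definition dm_params_of :: "'a measure \<Rightarrow> ('a \<Rightarrow> 'a measure) \<Rightarrow> dm_param set" where
  "dm_params_of M P = {\<theta> \<in> dm_params. satisfies_dm M P \<theta>}"

text \<open>
  \<open>U\<close> is the fixed set of admissible state spaces. A kernel is listed together with its state
  space and its stationary distribution, which is unique for parameters in \<open>dm_params\<close>.
\<close>

definition nonneg_kernels ::
    "'s measure set \<Rightarrow> dm_param \<Rightarrow> ('s measure \<times> ('s \<Rightarrow> 's measure) \<times> 's measure) set" where
  "nonneg_kernels U \<theta> =
     {(M, Q, \<pi>). M \<in> U \<and> markov_kernel M Q \<and> stationary_distribution M Q \<pi> \<and>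
        reversible_kernel Q \<pi> \<and> nonneg_definite_kernel Q \<pi> \<and> satisfies_dm M Q \<theta>}"

definition rho_opt_nonneg :: "'s measure set \<Rightarrow> dm_param \<Rightarrow> ereal" where
  "rho_opt_nonneg U \<theta> = (SUP (M, Q, \<pi>)\<in>nonneg_kernels U \<theta>. conv_rate M Q \<pi>)"

definition rho_opt_chain :: "'s measure set \<Rightarrow> 'a measure \<Rightarrow> ('a \<Rightarrow> 'a measure) \<Rightarrow> ereal" where
  "rho_opt_chain U M P =
     (if dm_params_of M P = {} then 1 else (INF \<theta>\<in>dm_params_of M P. rho_opt_nonneg U \<theta>))"

subsection \<open>The Gaussian chain\<close>

text \<open>
  Since the dimension varies, \<open>\<real>\<^sup>n\<close> is represented by the extensional functions on \<open>{..<n}\<close>;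
  the product of the one-dimensional Borel \<open>\<sigma>\<close>-algebras is its Borel \<open>\<sigma>\<close>-algebra, and
  \<open>L2_set\<close> is the Euclidean norm.
\<close>

definition Rn_space :: "nat \<Rightarrow> (nat \<Rightarrow> real) measure" where
  "Rn_space n = (\<Pi>\<^sub>M i\<in>{..<n}. borel)"

definition Rn_lebesgue :: "nat \<Rightarrow> (nat \<Rightarrow> real) measure" where
  "Rn_lebesgue n = (\<Pi>\<^sub>M i\<in>{..<n}. lborel)"

definition gauss_weight :: "nat \<Rightarrow> (nat \<Rightarrow> real) \<Rightarrow> (nat \<Rightarrow> real) \<Rightarrow> real" where
  "gauss_weight n x y = exp (- (2 / 3) * (L2_set (\<lambda>i. y i - x i / 2) {..<n})\<^sup>2)"

definition gauss_kernel :: "nat \<Rightarrow> (nat \<Rightarrow> real) \<Rightarrow> (nat \<Rightarrow> real) measure" where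
  "gauss_kernel n x =
     density (Rn_lebesgue n)
       (\<lambda>y. ennreal (gauss_weight n x y / (\<integral>z. gauss_weight n x z \<partial>Rn_lebesgue n)))"

end

theory Submission
  imports Defs
begin

text \<open>
  A parameter \<open>(\<lambda>, K, \<epsilon>, \<beta>)\<close> cannot certify a convergence rate below \<open>max \<lambda> (1 - \<epsilon>)\<close>. The
  witness has two states: the state \<open>a\<close> is absorbing, and the state \<open>b\<close> is kept with probability
  \<open>r\<close> and left for \<open>a\<close> otherwise. Its rate is \<open>r\<close>, its stationary distribution is the point mass
  at \<open>a\<close>, so that reversibility and non-negative definiteness hold trivially, and it satisfies the
  drift and minorization conditions for every choice of the other parameters as soon as
  \<open>r < \<lambda>\<close> (with small set \<open>{a}\<close>) or \<open>r \<le> 1 - \<epsilon>\<close> (with the whole space as small set); this is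
  \<open>rho_opt_nonneg_lower_bound\<close>. It remains to see that in high dimension every admissible
  parameter of the Gaussian chain has \<open>\<lambda>\<close> close to 1 or \<open>\<epsilon>\<close> close to 0.

  A minorization with \<open>\<epsilon>\<close> bounded below confines the small set \<open>C\<close> to a cube whose side does not
  depend on the dimension: the kernel acts coordinate by coordinate, and by Chebyshev two points
  that are far apart in one coordinate have almost mutually singular transition laws. A cube of
  fixed side has stationary probability at most \<open>q ^ n\<close> with \<open>q < 1\<close>.

  A reversible chain with a small set \<open>C\<close> of small stationary probability must have a drift factor
  close to 1 (\<open>reversible_drift_factor_lower_bound\<close>). The drift condition makes the mean of
  \<open>V y / V x\<close> under a stationary transition from \<open>x\<close> to \<open>y\<close>, restricted to \<open>x, y \<notin> C\<close>, at most
  \<open>\<lambda>\<close>. By reversibility \<open>V x / V y\<close> has the same mean, and \<open>u / v + v / u \<ge> 2\<close>, so this mean is at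
  least the probability of \<open>x, y \<notin> C\<close>, hence at least \<open>1 - 2 \<pi>(C)\<close>. The argument compares
  ratios because \<open>V\<close> itself may have infinite mean under \<open>\<pi>\<close>.
\<close>

section \<open>Convergence rates are at most one\<close>

lemma kernel_power_in_prob_algebra:
  assumes "P \<in> measurable M (prob_algebra M)" "x \<in> space M"
  shows "kernel_power M P m x \<in> space (prob_algebra M)"
proof (induction m)
  case 0
  show ?case
    using assms(2) by (simp add: space_prob_algebra prob_space_return)
next
  case (Suc m)
  then show ?case
    using prob_space_bind'[OF _ assms(1)] sets_bind'[OF _ assms(1)]
    by (simp add: space_prob_algebra)
qed

lemma tv_dist_le_1:
  assumes "\<mu> \<in> space (prob_algebra M)"
  shows "tv_dist M \<mu> \<nu> \<le> 1"
proof -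
  interpret prob_space \<mu> using assms by (simp add: space_prob_algebra)
  have "measure \<mu> A - measure \<nu> A \<le> 1" for A
    using prob_le_1[of A] measure_nonneg[of \<nu> A] by linarith
  then show ?thesis
    unfolding tv_dist_def by (intro cSUP_least) auto
qed

lemma le_tv_dist:
  assumes "\<mu> \<in> space (prob_algebra M)" "A \<in> sets M"
  shows "measure \<mu> A - measure \<nu> A \<le> tv_dist M \<mu> \<nu>"
proof -
  interpret prob_space \<mu> using assms by (simp add: space_prob_algebra)
  have "measure \<mu> A - measure \<nu> A \<le> 1" for A
    using prob_le_1[of A] measure_nonneg[of \<nu> A] by linarith
  then show ?thesis
    unfolding tv_dist_def using assms(2) by (intro cSUP_upper bdd_aboveI2) auto
qed

lemma exp_ext_mono: "s \<le> t \<Longrightarrow> exp_ext s \<le> exp_ext t"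
  by (cases s; cases t) (auto simp: exp_ext_def)

lemma conv_rate_le_1:
  assumes "P \<in> measurable M (prob_algebra M)"
  shows "conv_rate M P \<pi> \<le> 1"
proof -
  have "log_ext (tv_dist M (kernel_power M P m x) \<pi>) / ereal (real m) \<le> 0" if "x \<in> space M" for m x
  proof -
    have "tv_dist M (kernel_power M P m x) \<pi> \<le> 1"
      using kernel_power_in_prob_algebra[OF assms that] by (rule tv_dist_le_1)
    then have "log_ext (tv_dist M (kernel_power M P m x) \<pi>) \<le> 0"
      by (simp add: log_ext_def)
    then show ?thesis
      by (simp add: divide_ereal_def ereal_mult_le_0_iff)
  qed
  then have "(SUP x\<in>space M. limsup (\<lambda>m. log_ext (tv_dist M (kernel_power M P m x) \<pi>) / ereal (real m))) \<le> 0"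
    by (intro SUP_least Limsup_bounded) auto
  from exp_ext_mono[OF this] have "conv_rate M P \<pi> \<le> exp_ext 0"
    unfolding conv_rate_def .
  then show ?thesis
    by (simp add: exp_ext_def one_ereal_def)
qed

lemma rho_opt_chain_le_1: "rho_opt_chain U M P \<le> 1"
proof -
  have "rho_opt_nonneg U \<theta> \<le> 1" for \<theta>
    unfolding rho_opt_nonneg_def
    by (rule SUP_least) (auto simp: nonneg_kernels_def markov_kernel_def conv_rate_le_1)
  then show ?thesis
    unfolding rho_opt_chain_def by (auto intro: INF_lower2)
qed

section \<open>A two-state chain with an absorbing state\<close>

text \<open>
  The kernel is the push-forward of a coin toss, which makes it a probability measure on \<open>N\<close> and
  reduces all integrals against it to two-term sums.
\<close>

definition lazy_absorption :: "'s measure \<Rightarrow> 's \<Rightarrow> real \<Rightarrow> 's \<Rightarrow> 's measure" where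
  "lazy_absorption N a r x = distr (measure_pmf (bernoulli_pmf r)) N (\<lambda>stay. if stay then x else a)"

locale two_state_chain =
  fixes N :: "'s measure" and a b :: 's and r :: real
  assumes sets_N: "sets N = Pow {a, b}" and a_neq_b: "a \<noteq> b" and r: "0 < r" "r < 1"
begin

abbreviation "Q \<equiv> lazy_absorption N a r"

lemma space_N: "space N = {a, b}"
  using sets_N by (metis Pow_top Union_Pow_eq sets.sets_into_space sets.top Pow_iff subset_antisym)

lemma measurable_N: "f \<in> measurable N M \<longleftrightarrow> f \<in> {a, b} \<rightarrow> space M"
  using sets_N by (auto simp: measurable_def space_N)

lemma sets_Q: "sets (Q x) = sets N"
  by (simp add: lazy_absorption_def)

lemma kernel_Q: "Q \<in> measurable N (prob_algebra N)"
proof -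
  have "prob_space (Q x)" if "x \<in> {a, b}" for x
    unfolding lazy_absorption_def using that
    by (intro prob_space.prob_space_distr prob_space_measure_pmf) (auto simp: space_N)
  then show ?thesis
    by (auto simp: measurable_N space_prob_algebra sets_Q)
qed

lemma markov_kernel_Q: "markov_kernel N Q"
  unfolding markov_kernel_def countably_generated_space_def
proof (intro conjI exI)
  show "countable (sets N)"
    by (rule countable_finite) (simp add: sets_N)
  show "sets N = sigma_sets (space N) (sets N)"
    by (rule sets.sigma_sets_eq[symmetric])
qed (use kernel_Q sets.space_closed in auto)

lemma nn_integral_Q:
  assumes "x \<in> {a, b}"
  shows "(\<integral>\<^sup>+y. f y \<partial>Q x) = f x * r + f a * (1 - r)"
proof -
  have "f \<in> borel_measurable N" by (simp add: measurable_N)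
  then show ?thesis
    unfolding lazy_absorption_def using assms r
    by (subst nn_integral_distr) (auto simp: space_N)
qed

lemma integral_Q:
  fixes f :: "'s \<Rightarrow> real"
  assumes "x \<in> {a, b}"
  shows "(\<integral>y. f y \<partial>Q x) = f x * r + f a * (1 - r)"
proof -
  have "f \<in> borel_measurable N" by (simp add: measurable_N)
  then show ?thesis
    unfolding lazy_absorption_def using assms r
    by (subst integral_distr) (auto simp: space_N)
qed

lemma emeasure_Q:
  assumes "x \<in> {a, b}" "A \<in> sets N"
  shows "emeasure (Q x) A = ennreal (indicator A x * r + indicator A a * (1 - r))"
proof -
  have "emeasure (Q x) A = indicator A x * ennreal r + indicator A a * ennreal (1 - r)"
    using nn_integral_Q[OF assms(1), of "indicator A"] assms(2) by (simp add: sets_Q)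
  also have "\<dots> = ennreal (indicator A x * r + indicator A a * (1 - r))"
    using r by (cases "x \<in> A"; cases "a \<in> A") (simp_all flip: ennreal_plus)
  finally show ?thesis .
qed

lemma measure_Q:
  assumes "x \<in> {a, b}" "A \<in> sets N"
  shows "measure (Q x) A = indicator A x * r + indicator A a * (1 - r)"
  using r unfolding measure_def emeasure_Q[OF assms] by (intro enn2real_ennreal) simp

lemma stationary_Q: "stationary_distribution N Q (return N a)"
proof -
  have "return N a \<bind> Q = Q a"
    using kernel_Q by (intro bind_return[where N=N]) (auto simp: space_N measurable_prob_algebraD)
  moreover have "Q a = return N a"
  proof (rule measure_eqI)
    fix A assume "A \<in> sets (Q a)"
    then show "emeasure (Q a) A = emeasure (return N a) A"
      using r by (auto simp: sets_Q emeasure_Q indicator_def ennreal_plus[symmetric] simp del: ennreal_plus)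
  qed (simp add: sets_Q)
  ultimately show ?thesis
    by (simp add: stationary_distribution_def space_prob_algebra space_N prob_space_return)
qed

lemma integral_absorbed: "(\<integral>x. f x \<partial>return N a) = f a" for f :: "'s \<Rightarrow> real"
  by (rule integral_return) (auto simp: space_N measurable_N)

lemma reversible_Q: "reversible_kernel Q (return N a)"
  unfolding reversible_kernel_def integral_absorbed
  by (simp add: integral_Q flip: distrib_left)

lemma nonneg_definite_Q: "nonneg_definite_kernel Q (return N a)"
  unfolding nonneg_definite_kernel_def integral_absorbed
  by (simp add: integral_Q flip: distrib_left)

text \<open>The state \<open>a\<close> is absorbing, so being at \<open>b\<close> after \<open>m\<close> steps means never having left it.\<close>

lemma kernel_power_Q: "emeasure (kernel_power N Q m b) {b} = ennreal (r ^ m)"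
proof (induction m)
  case 0
  show ?case by (simp add: sets_N)
next
  case (Suc m)
  let ?K = "kernel_power N Q m b"
  have K: "?K \<in> space (prob_algebra N)"
    by (rule kernel_power_in_prob_algebra[OF kernel_Q]) (simp add: space_N)
  then have sets_K: "sets ?K = sets N" and space_K: "space ?K = {a, b}"
    using sets_eq_imp_space_eq[of ?K N] by (simp_all add: space_prob_algebra space_N)
  have "emeasure (kernel_power N Q (Suc m) b) {b} = (\<integral>\<^sup>+x. emeasure (Q x) {b} \<partial>?K)"
    using emeasure_bind_prob_algebra[OF K kernel_Q, of "{b}"] by (simp add: sets_N)
  also have "\<dots> = (\<integral>\<^sup>+x. ennreal r * indicator {b} x \<partial>?K)"
    using a_neq_b by (intro nn_integral_cong) (auto simp: space_K sets_N emeasure_Q indicator_def)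
  also have "\<dots> = ennreal r * ennreal (r ^ m)"
    using Suc by (subst nn_integral_cmult_indicator) (auto simp: sets_K sets_N)
  finally show ?case
    using r by (simp add: ennreal_mult)
qed

lemma conv_rate_Q: "ereal r \<le> conv_rate N Q (return N a)"
proof -
  let ?\<pi> = "return N a"
  let ?u = "\<lambda>m. log_ext (tv_dist N (kernel_power N Q m b) ?\<pi>) / ereal (real m)"
  have "ereal (ln r) \<le> ?u m" if "m \<ge> 1" for m
  proof -
    have "measure (kernel_power N Q m b) {b} - measure ?\<pi> {b} \<le> tv_dist N (kernel_power N Q m b) ?\<pi>"
      by (rule le_tv_dist[OF kernel_power_in_prob_algebra[OF kernel_Q]]) (auto simp: space_N sets_N)
    then have tv: "r ^ m \<le> tv_dist N (kernel_power N Q m b) ?\<pi>"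
      using kernel_power_Q[of m] a_neq_b r by (simp add: measure_def sets_N)
    moreover have "0 < r ^ m" using r by simp
    ultimately have "real m * ln r \<le> ln (tv_dist N (kernel_power N Q m b) ?\<pi>)"
      using r by (metis ln_le_cancel_iff ln_realpow order_less_le_trans)
    moreover have "0 < tv_dist N (kernel_power N Q m b) ?\<pi>"
      using tv \<open>0 < r ^ m\<close> by linarith
    ultimately show ?thesis
      using that by (simp add: log_ext_def field_simps)
  qed
  then have "ereal (ln r) \<le> limsup ?u"
    by (intro le_Limsup) (auto intro: eventually_sequentiallyI)
  also have "\<dots> \<le> (SUP x\<in>space N. limsup (\<lambda>m. log_ext (tv_dist N (kernel_power N Q m x) ?\<pi>) / ereal (real m)))"
    by (rule SUP_upper) (simp add: space_N)
  finally show ?thesis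
    using exp_ext_mono[of "ereal (ln r)"] r unfolding conv_rate_def by (simp add: exp_ext_def)
qed

text \<open>
  If \<open>r < l\<close>, the small set is \<open>{a}\<close>, where \<open>V = 1\<close> and the chain stays forever;
  off it, a large value of \<open>V\<close> at \<open>b\<close> makes the cost 1 of a jump to \<open>a\<close> negligible. If \<open>r \<le> 1 - \<epsilon>\<close>, the
  small set is everything, and the jump probability \<open>1 - r\<close> supplies the minorization by the
  point mass at \<open>a\<close>.
\<close>

lemma satisfies_dm_Q:
  assumes \<theta>: "(l, K, \<epsilon>, \<beta>) \<in> dm_params" and r_le: "r < l \<or> r \<le> 1 - \<epsilon>"
  shows "satisfies_dm N Q (l, K, \<epsilon>, \<beta>)"
proof -
  have params: "0 \<le> l" "l < 1" "1 \<le> K" "0 < \<epsilon>" "\<epsilon> \<le> 1" "0 < \<beta>" "\<beta> \<le> 1"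
    using \<theta> by (auto simp: dm_params_def)
  have \<nu>: "return N a \<in> space (prob_algebra N)"
    by (simp add: space_prob_algebra space_N prob_space_return)
  show ?thesis
    using r_le
  proof
    assume "r < l"
    \<comment> \<open>the solution of \<open>v * r + (1 - r) = l * v\<close>, the drift condition at \<open>b\<close> with equality\<close>
    define v where "v = (1 - r) / (l - r)"
    have v: "1 \<le> v" "v * r + (1 - r) \<le> l * v"
      using \<open>r < l\<close> params by (auto simp: v_def field_simps)
    define V where "V = (\<lambda>x. if x = a then 1 else v)"
    have "(\<integral>\<^sup>+y. ennreal (V y) \<partial>Q x) \<le> ennreal (l * V x * indicator (space N - {a}) x + K * indicator {a} x)"
      if "x \<in> space N" for x
    proof -
      have "(\<integral>\<^sup>+y. ennreal (V y) \<partial>Q x) = ennreal (V x * r + (1 - r))"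
        using that v r by (subst nn_integral_Q) (auto simp: space_N V_def ennreal_mult)
      also have "\<dots> \<le> ennreal (l * V x * indicator (space N - {a}) x + K * indicator {a} x)"
        using that v params a_neq_b by (intro ennreal_leI) (auto simp: space_N V_def)
      finally show ?thesis .
    qed
    moreover have "\<epsilon> * measure (return N a) A \<le> measure (Q x) A" if "x \<in> {a}" "A \<in> sets N" for x A
      using that params by (auto simp: measure_Q measure_return indicator_def)
    ultimately show ?thesis
      unfolding satisfies_dm.simps using \<nu> v(1) params
      by (intro exI[of _ "{a}"] exI[of _ V] exI[of _ "return N a"])
         (auto simp: sets_N measurable_N V_def measure_return)
  next
    assume "r \<le> 1 - \<epsilon>"
    have "\<epsilon> * measure (return N a) A \<le> measure (Q x) A" if "x \<in> {a, b}" "A \<in> sets N" for x A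
      using that params r \<open>r \<le> 1 - \<epsilon>\<close> by (auto simp: measure_Q measure_return indicator_def)
    moreover have "(\<integral>\<^sup>+y. ennreal 1 \<partial>Q x) \<le> ennreal (l * 1 * indicator (space N - {a, b}) x + K * indicator {a, b} x)"
      if "x \<in> space N" for x
      using that params r
      by (subst nn_integral_Q) (auto simp: space_N indicator_def ennreal_plus[symmetric] simp del: ennreal_plus)
    ultimately show ?thesis
      unfolding satisfies_dm.simps using \<nu> params
      by (intro exI[of _ "{a, b}"] exI[of _ "\<lambda>_. 1"] exI[of _ "return N a"])
         (auto simp: sets_N measurable_N measure_return)
  qed
qed

end

lemma rho_opt_nonneg_lower_bound:
  assumes "N \<in> U" "sets N = Pow {a, b}" "a \<noteq> b" "0 < r" "r < 1"
    and "(l, K, \<epsilon>, \<beta>) \<in> dm_params" "r < l \<or> r \<le> 1 - \<epsilon>"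
  shows "ereal r \<le> rho_opt_nonneg U (l, K, \<epsilon>, \<beta>)"
proof -
  interpret two_state_chain N a b r by standard fact+
  have "(N, Q, return N a) \<in> nonneg_kernels U (l, K, \<epsilon>, \<beta>)"
    using assms markov_kernel_Q stationary_Q reversible_Q nonneg_definite_Q satisfies_dm_Q
    by (auto simp: nonneg_kernels_def)
  then show ?thesis
    unfolding rho_opt_nonneg_def using conv_rate_Q by (auto intro!: SUP_upper2)
qed


section \<open>The drift factor of a reversible chain\<close>

lemma ratio_add_inverse_ratio_ge_2:
  assumes "0 < u" "0 < (v::real)"
  shows "2 \<le> u / v + v / u"
proof -
  have "0 \<le> (u - v)\<^sup>2 / (u * v)" using assms by simp
  also have "\<dots> = u / v + v / u - 2"
    using assms by (simp add: power2_eq_square field_simps)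
  finally show ?thesis by simp
qed

text \<open>
  For a stationary transition from \<open>x\<close> to \<open>y\<close>, symmetrize the mean of \<open>V y / V x\<close> over
  \<open>x, y \<notin> C\<close> and use that a positive number plus its inverse is at least 2. In the other
  direction the drift condition bounds this mean by \<open>l\<close>.
\<close>

lemma reversible_drift_factor_lower_bound:
  fixes M :: "'a measure"
  assumes \<pi>: "\<pi> \<in> space (prob_algebra M)" and P[measurable]: "P \<in> measurable M (prob_algebra M)"
    and balance: "\<And>f. f \<in> borel_measurable (M \<Otimes>\<^sub>M M) \<Longrightarrow>
      (\<integral>\<^sup>+x. (\<integral>\<^sup>+y. f (x, y) \<partial>P x) \<partial>\<pi>) = (\<integral>\<^sup>+x. (\<integral>\<^sup>+y. f (y, x) \<partial>P x) \<partial>\<pi>)"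
    and C[measurable]: "C \<in> sets M" and V[measurable]: "V \<in> borel_measurable M"
    and V_pos: "\<And>x. x \<in> space M \<Longrightarrow> 0 < V x" and "0 \<le> l"
    and drift: "\<And>x. x \<in> space M - C \<Longrightarrow> (\<integral>\<^sup>+y. ennreal (V y) \<partial>P x) \<le> ennreal (l * V x)"
  shows "1 - 2 * measure \<pi> C \<le> l"
proof -
  interpret \<pi>: prob_space \<pi> using \<pi> by (simp add: space_prob_algebra)
  have sets_\<pi>[measurable_cong]: "sets \<pi> = sets M" using \<pi> by (simp add: space_prob_algebra)
  then have space_\<pi>: "space \<pi> = space M" by (rule sets_eq_imp_space_eq)
  note [measurable] = measurable_prob_algebraD[OF P]
  have P_prob: "prob_space (P x)" and sets_P: "sets (P x) = sets M" if "x \<in> space M" for x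
    using measurable_space[OF P that] by (simp_all add: space_prob_algebra)
  define D where "D = (\<lambda>x. indicator (space M - C) x :: ennreal)"
  have D[measurable]: "D \<in> borel_measurable M" unfolding D_def by measurable
  \<comment> \<open>integration over the joint law of \<open>x \<sim> \<pi>\<close> and \<open>y \<sim> P x\<close>\<close>
  define J where "J = (\<lambda>f. \<integral>\<^sup>+x. (\<integral>\<^sup>+y. f (x, y) \<partial>P x) \<partial>\<pi>)"
  have J_meas: "(\<lambda>x. \<integral>\<^sup>+y. f (x, y) \<partial>P x) \<in> borel_measurable \<pi>"
    if "f \<in> borel_measurable (M \<Otimes>\<^sub>M M)" for f
    using that nn_integral_measurable_subprob_algebra2[of "\<lambda>x y. f (x, y)" M M P] measurable_prob_algebraD[OF P]
    by (simp add: measurable_cong_sets[OF sets_\<pi> refl])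
  have J_add: "J (\<lambda>z. f z + g z) = J f + J g"
    if [measurable]: "f \<in> borel_measurable (M \<Otimes>\<^sub>M M)" "g \<in> borel_measurable (M \<Otimes>\<^sub>M M)" for f g
  proof -
    have "J (\<lambda>z. f z + g z) = (\<integral>\<^sup>+x. (\<integral>\<^sup>+y. f (x, y) \<partial>P x) + (\<integral>\<^sup>+y. g (x, y) \<partial>P x) \<partial>\<pi>)"
      unfolding J_def space_\<pi> by (intro nn_integral_cong nn_integral_add) (auto simp: space_\<pi> measurable_cong_sets[OF sets_P refl])
    also have "\<dots> = J f + J g"
      unfolding J_def by (intro nn_integral_add J_meas that)
    finally show ?thesis .
  qed
  have J_mono: "J f \<le> J g" if "\<And>x y. x \<in> space M \<Longrightarrow> y \<in> space M \<Longrightarrow> f (x, y) \<le> g (x, y)" for f g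
    unfolding J_def
    by (intro nn_integral_mono) (auto intro!: that simp: space_\<pi> sets_eq_imp_space_eq[OF sets_P])
  define R where "R = (\<lambda>(x, y). D x * D y * ennreal (V y / V x))"
  define R' where "R' = (\<lambda>(x, y). D x * D y * ennreal (V x / V y))"
  define I1 where "I1 = (\<lambda>(x::'a, y::'a). indicator C x :: ennreal)"
  define I2 where "I2 = (\<lambda>(x::'a, y::'a). indicator C y :: ennreal)"
  have meas[measurable]: "R \<in> borel_measurable (M \<Otimes>\<^sub>M M)" "R' \<in> borel_measurable (M \<Otimes>\<^sub>M M)"
    "I1 \<in> borel_measurable (M \<Otimes>\<^sub>M M)" "I2 \<in> borel_measurable (M \<Otimes>\<^sub>M M)"
    unfolding R_def R'_def I1_def I2_def by measurable
  have J_I1: "J I1 = emeasure \<pi> C"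
  proof -
    have "J I1 = (\<integral>\<^sup>+x. indicator C x \<partial>\<pi>)"
      unfolding J_def by (intro nn_integral_cong) (simp add: I1_def space_\<pi> P_prob prob_space.emeasure_space_1)
    then show ?thesis by (simp add: sets_\<pi> C)
  qed
  then have J_I2: "J I2 = emeasure \<pi> C"
    using balance[OF meas(3)] by (simp add: J_def I1_def I2_def)
  have J1: "J (\<lambda>_. 1) = 1"
    unfolding J_def using \<pi>.emeasure_space_1
    by (subst nn_integral_cong[where v="\<lambda>_. 1"]) (auto simp: space_\<pi> P_prob prob_space.emeasure_space_1)
  \<comment> \<open>off \<open>C\<close>, the drift condition bounds the mean of \<open>V y / V x\<close> under \<open>P x\<close>\<close>
  have "J R \<le> ennreal l"
  proof -
    have "(\<integral>\<^sup>+y. R (x, y) \<partial>P x) \<le> ennreal l" if x: "x \<in> space M" for x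
    proof (cases "x \<in> C")
      case True
      then show ?thesis by (simp add: R_def D_def)
    next
      case False
      have "(\<integral>\<^sup>+y. R (x, y) \<partial>P x) \<le> (\<integral>\<^sup>+y. ennreal (1 / V x) * ennreal (V y) \<partial>P x)"
        using V_pos[OF x]
        by (intro nn_integral_mono)
           (auto simp: R_def D_def indicator_def ennreal_mult'[symmetric] sets_eq_imp_space_eq[OF sets_P[OF x]] less_imp_le[OF V_pos])
      also have "\<dots> = ennreal (1 / V x) * (\<integral>\<^sup>+y. ennreal (V y) \<partial>P x)"
        by (intro nn_integral_cmult) (simp add: measurable_cong_sets[OF sets_P[OF x] refl])
      also have "\<dots> \<le> ennreal (1 / V x) * ennreal (l * V x)"
        using drift[of x] x False by (intro mult_left_mono) auto
      also have "\<dots> = ennreal l"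
        using V_pos[OF x] \<open>0 \<le> l\<close> by (simp add: ennreal_mult'[symmetric])
      finally show ?thesis .
    qed
    then have "J R \<le> (\<integral>\<^sup>+x. ennreal l \<partial>\<pi>)"
      unfolding J_def by (intro nn_integral_mono) (simp add: space_\<pi>)
    then show ?thesis by (simp add: \<pi>.emeasure_space_1)
  qed
  moreover have "J R' = J R"
    using balance[OF meas(1)] by (simp add: J_def R_def R'_def mult.commute)
  ultimately have J_R: "J (\<lambda>z. R z + R' z) \<le> ennreal l + ennreal l"
    by (simp add: J_add add_mono)
  \<comment> \<open>\<open>?S\<close> covers the pairs with a point in \<open>C\<close>; doubled, it matches the bound 2 that holds off \<open>C\<close>\<close>
  let ?S = "\<lambda>z. I1 z + I2 z"
  have "1 + 1 = J (\<lambda>_. 1 + 1)"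
    by (subst J_add) (simp_all add: J1)
  also have "\<dots> \<le> J (\<lambda>z. (R z + R' z) + (?S z + ?S z))"
  proof (rule J_mono)
    fix x y assume xy: "x \<in> space M" "y \<in> space M"
    show "1 + 1 \<le> (R (x, y) + R' (x, y)) + (?S (x, y) + ?S (x, y))"
    proof (cases "x \<in> C \<or> y \<in> C")
      case True
      then have "1 \<le> ?S (x, y)"
        by (auto simp: I1_def I2_def indicator_def)
      then have "1 + 1 \<le> ?S (x, y) + ?S (x, y)"
        by (rule add_mono) fact
      then show ?thesis by (rule add_increasing[OF zero_le])
    next
      case False
      have "2 \<le> V y / V x + V x / V y"
        using V_pos xy by (intro ratio_add_inverse_ratio_ge_2) auto
      then have "ennreal 2 \<le> ennreal (V y / V x + V x / V y)" by (rule ennreal_leI)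
      also have "\<dots> = R (x, y) + R' (x, y)"
        using False xy V_pos[of x] V_pos[of y] by (simp add: R_def R'_def D_def ennreal_plus)
      finally show ?thesis by (simp add: add_increasing2)
    qed
  qed
  also have "\<dots> = J (\<lambda>z. R z + R' z) + J (\<lambda>z. ?S z + ?S z)"
    by (rule J_add; measurable)
  also have "J (\<lambda>z. ?S z + ?S z) = J ?S + J ?S"
    by (rule J_add; measurable)
  also have "J ?S = emeasure \<pi> C + emeasure \<pi> C"
    by (subst J_add) (simp_all add: J_I1 J_I2)
  also note J_R
  also have "ennreal l + ennreal l + ((emeasure \<pi> C + emeasure \<pi> C) + (emeasure \<pi> C + emeasure \<pi> C))
      = ennreal (2 * l + 4 * measure \<pi> C)"
    using \<open>0 \<le> l\<close> by (simp add: \<pi>.emeasure_eq_measure flip: ennreal_plus)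
  finally have "ennreal 2 \<le> ennreal (2 * l + 4 * measure \<pi> C)"
    by simp
  then show ?thesis
    using \<open>0 \<le> l\<close> by (subst (asm) ennreal_le_iff) auto
qed

section \<open>Gaussian product measures\<close>

lemma density_PiM:
  assumes I: "finite I" and M: "\<And>i. sigma_finite_measure (M i)"
    and f[measurable]: "\<And>i. f i \<in> borel_measurable (M i)"
    and fM: "\<And>i. sigma_finite_measure (density (M i) (f i))"
  shows "density (PiM I M) (\<lambda>x. \<Prod>i\<in>I. f i (x i)) = PiM I (\<lambda>i. density (M i) (f i))"
proof (rule product_sigma_finite.PiM_eqI)
  show "product_sigma_finite (\<lambda>i. density (M i) (f i))"
    by (simp add: product_sigma_finite_def fM)
  show "finite I" by fact
  show "sets (density (PiM I M) (\<lambda>x. \<Prod>i\<in>I. f i (x i))) = sets (PiM I (\<lambda>i. density (M i) (f i)))"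
    by (simp cong: sets_PiM_cong)
next
  fix A assume "\<And>i. i \<in> I \<Longrightarrow> A i \<in> sets (density (M i) (f i))"
  then have A[measurable]: "A i \<in> sets (M i)" if "i \<in> I" for i using that by simp
  have "emeasure (density (PiM I M) (\<lambda>x. \<Prod>i\<in>I. f i (x i))) (Pi\<^sub>E I A)
      = (\<integral>\<^sup>+x. (\<Prod>i\<in>I. f i (x i)) * indicator (Pi\<^sub>E I A) x \<partial>PiM I M)"
    using I A by (intro emeasure_density) (auto intro!: sets_PiM_I_finite)
  also have "\<dots> = (\<integral>\<^sup>+x. (\<Prod>i\<in>I. f i (x i) * indicator (A i) (x i)) \<partial>PiM I M)"
  proof (intro nn_integral_cong)
    fix x assume x: "x \<in> space (PiM I M)"
    have "indicator (Pi\<^sub>E I A) x = (\<Prod>i\<in>I. indicator (A i) (x i) :: ennreal)"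
    proof (cases "x \<in> Pi\<^sub>E I A")
      case True
      then show ?thesis by (auto simp: PiE_iff)
    next
      case False
      then obtain i where "i \<in> I" "x i \<notin> A i"
        using x by (auto simp: PiE_iff space_PiM)
      then have "(\<Prod>i\<in>I. indicator (A i) (x i) :: ennreal) = 0"
        using I by (intro prod_zero) (auto simp: indicator_def)
      then show ?thesis using False by simp
    qed
    then show "(\<Prod>i\<in>I. f i (x i)) * indicator (Pi\<^sub>E I A) x = (\<Prod>i\<in>I. f i (x i) * indicator (A i) (x i))"
      by (simp add: prod.distrib)
  qed
  also have "\<dots> = (\<Prod>i\<in>I. \<integral>\<^sup>+x. f i x * indicator (A i) x \<partial>M i)"
    using I M A by (intro product_sigma_finite.product_nn_integral_prod) (auto simp: product_sigma_finite_def)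
  also have "\<dots> = (\<Prod>i\<in>I. emeasure (density (M i) (f i)) (A i))"
    using A by (intro prod.cong refl emeasure_density[symmetric]) auto
  finally show "emeasure (density (PiM I M) (\<lambda>x. \<Prod>i\<in>I. f i (x i))) (Pi\<^sub>E I A)
      = (\<Prod>i\<in>I. emeasure (density (M i) (f i)) (A i))" .
qed

definition normal_measure :: "real \<Rightarrow> real \<Rightarrow> real measure" where
  "normal_measure \<mu> \<sigma> = density lborel (\<lambda>x. ennreal (normal_density \<mu> \<sigma> x))"

lemma sets_normal_measure[simp, measurable_cong]: "sets (normal_measure \<mu> \<sigma>) = sets borel"
  by (simp add: normal_measure_def)

lemma space_normal_measure[simp]: "space (normal_measure \<mu> \<sigma>) = UNIV"
  by (simp add: normal_measure_def)

lemma prob_space_normal_measure: "0 < \<sigma> \<Longrightarrow> prob_space (normal_measure \<mu> \<sigma>)"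
  unfolding normal_measure_def by (rule prob_space_normal_density)

lemma sigma_finite_Rn_lebesgue: "sigma_finite_measure (Rn_lebesgue n)"
  unfolding Rn_lebesgue_def
  by (rule product_sigma_finite.sigma_finite) (auto simp: product_sigma_finite_def sigma_finite_lborel)

lemma sets_Rn_lebesgue[measurable_cong]: "sets (Rn_lebesgue n) = sets (Rn_space n)"
  unfolding Rn_lebesgue_def Rn_space_def by (rule sets_PiM_cong) auto

lemma space_Rn_lebesgue: "space (Rn_lebesgue n) = space (Rn_space n)"
  by (rule sets_eq_imp_space_eq[OF sets_Rn_lebesgue])

lemma density_Rn_lebesgue_normal:
  assumes "0 < \<sigma>"
  shows "density (Rn_lebesgue n) (\<lambda>y. \<Prod>i<n. ennreal (normal_density (m i) \<sigma> (y i)))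
    = (\<Pi>\<^sub>M i\<in>{..<n}. normal_measure (m i) \<sigma>)"
  unfolding Rn_lebesgue_def normal_measure_def
  by (rule density_PiM)
     (auto simp: sigma_finite_lborel prob_space_normal_density assms intro!: prob_space_imp_sigma_finite)

text \<open>Chebyshev's inequality: on the event, the integrand 1 is at most \<open>(y - \<mu>)\<^sup>2 / t\<^sup>2\<close>.\<close>

lemma normal_measure_tail:
  assumes \<sigma>: "0 < \<sigma>" and t: "0 < t"
  shows "measure (normal_measure \<mu> \<sigma>) {y. t \<le> \<bar>y - \<mu>\<bar>} \<le> \<sigma>\<^sup>2 / t\<^sup>2"
proof -
  have moment: "has_bochner_integral lborel (\<lambda>y. normal_density \<mu> \<sigma> y * (y - \<mu>)\<^sup>2) (\<sigma>\<^sup>2)"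
    using normal_moment_even[OF \<sigma>, of \<mu> 1] by simp
  have "emeasure (normal_measure \<mu> \<sigma>) {y. t \<le> \<bar>y - \<mu>\<bar>}
      = (\<integral>\<^sup>+y. ennreal (normal_density \<mu> \<sigma> y) * indicator {y. t \<le> \<bar>y - \<mu>\<bar>} y \<partial>lborel)"
    unfolding normal_measure_def by (rule emeasure_density) auto
  also have "\<dots> \<le> (\<integral>\<^sup>+y. ennreal (normal_density \<mu> \<sigma> y * (y - \<mu>)\<^sup>2 / t\<^sup>2) \<partial>lborel)"
  proof (intro nn_integral_mono)
    fix y
    have "normal_density \<mu> \<sigma> y \<le> normal_density \<mu> \<sigma> y * (y - \<mu>)\<^sup>2 / t\<^sup>2" if "t \<le> \<bar>y - \<mu>\<bar>"
    proof -
      have "t\<^sup>2 \<le> (y - \<mu>)\<^sup>2" using that t by (metis abs_le_square_iff abs_of_pos)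
      then have "1 \<le> (y - \<mu>)\<^sup>2 / t\<^sup>2" using t by simp
      from mult_left_mono[OF this normal_density_nonneg[of \<mu> \<sigma> y]] show ?thesis by simp
    qed
    then show "ennreal (normal_density \<mu> \<sigma> y) * indicator {y. t \<le> \<bar>y - \<mu>\<bar>} y
        \<le> ennreal (normal_density \<mu> \<sigma> y * (y - \<mu>)\<^sup>2 / t\<^sup>2)"
      by (auto simp: indicator_def intro!: ennreal_leI)
  qed
  also have "\<dots> = ennreal (\<sigma>\<^sup>2 / t\<^sup>2)"
    using has_bochner_integral_divide_zero[OF moment, of "t\<^sup>2"]
    by (subst nn_integral_eq_integral) (auto simp: has_bochner_integral_iff)
  finally have *: "emeasure (normal_measure \<mu> \<sigma>) {y. t \<le> \<bar>y - \<mu>\<bar>} \<le> ennreal (\<sigma>\<^sup>2 / t\<^sup>2)" .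
  interpret prob_space "normal_measure \<mu> \<sigma>" using \<sigma> by (rule prob_space_normal_measure)
  show ?thesis
    using * by (simp add: emeasure_eq_measure)
qed

lemma normal_measure_pos:
  assumes "0 < \<sigma>" "a < b"
  shows "0 < measure (normal_measure \<mu> \<sigma>) {a..b}"
proof (rule ccontr)
  interpret prob_space "normal_measure \<mu> \<sigma>" using assms(1) by (rule prob_space_normal_measure)
  assume "\<not> ?thesis"
  then have "measure (normal_measure \<mu> \<sigma>) {a..b} = 0"
    using measure_nonneg[of "normal_measure \<mu> \<sigma>" "{a..b}"] by linarith
  then have "{a..b} \<in> null_sets (normal_measure \<mu> \<sigma>)"
    by (auto simp: emeasure_eq_measure intro!: null_setsI)
  then have "AE x in lborel. x \<notin> {a..b}"
    unfolding normal_measure_def using normal_density_pos[OF assms(1)]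
    by (subst (asm) null_sets_density_iff) (auto simp: less_le)
  then have "emeasure lborel {a..b} = 0"
    by (subst (asm) AE_iff_measurable[where N="{a..b}"]) auto
  then show False using assms(2) by simp
qed

text \<open>
  An interval of length \<open>2 * D\<close> around a point \<open>a \<ge> 0\<close> cannot reach below \<open>- D\<close>, and one around
  \<open>a < 0\<close> cannot reach above \<open>D\<close>; in both cases it misses a fixed interval of positive mass.
\<close>

lemma standard_normal_intervals_bounded_away_from_1:
  obtains q where "0 \<le> q" "q < 1" "\<And>a. measure (normal_measure 0 1) {a - D..a + D} \<le> q"
proof -
  interpret prob_space "normal_measure 0 1" by (rule prob_space_normal_measure) simp
  let ?L = "{- D - 2..- D - 1}" and ?R = "{D + 1..D + 2}"
  define q where "q = 1 - min (prob ?L) (prob ?R)"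
  have "0 < prob ?L" "0 < prob ?R" by (auto intro!: normal_measure_pos)
  then have "q < 1" by (simp add: q_def)
  moreover have "0 \<le> q" using prob_le_1[of ?L] by (simp add: q_def min_def)
  moreover have "prob {a - D..a + D} \<le> q" for a
  proof -
    have *: "prob {a - D..a + D} \<le> 1 - prob B" if "{a - D..a + D} \<inter> B = {}" "B \<in> sets borel" for B
      using that finite_measure_Union[of "{a - D..a + D}" B] prob_le_1[of "{a - D..a + D} \<union> B"] by simp
    show ?thesis
    proof (cases "0 \<le> a")
      case True
      then have "prob {a - D..a + D} \<le> 1 - prob ?L" by (intro *) auto
      then show ?thesis by (simp add: q_def)
    next
      case False
      then have "prob {a - D..a + D} \<le> 1 - prob ?R" by (intro *) auto
      then show ?thesis by (simp add: q_def)
    qed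
  qed
  ultimately show ?thesis using that by blast
qed

section \<open>Drift and minorization parameters of the Gaussian chain\<close>

definition std_gauss :: "nat \<Rightarrow> (nat \<Rightarrow> real) measure" where
  "std_gauss n = (\<Pi>\<^sub>M i\<in>{..<n}. normal_measure 0 1)"

definition gauss_density :: "nat \<Rightarrow> (nat \<Rightarrow> real) \<Rightarrow> (nat \<Rightarrow> real) \<Rightarrow> ennreal" where
  "gauss_density n x y = (\<Prod>i<n. ennreal (normal_density (x i / 2) (sqrt 3 / 2) (y i)))"

lemma measurable_gauss_density[measurable]:
  "(\<lambda>(x, y). gauss_density n x y) \<in> borel_measurable (Rn_space n \<Otimes>\<^sub>M Rn_space n)"
  unfolding gauss_density_def normal_density_def Rn_space_def by measurable

lemma gauss_kernel_eq_density: "gauss_kernel n x = density (Rn_lebesgue n) (gauss_density n x)"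
proof -
  define c where "c = 1 / sqrt (2 * pi * (3 / 4))"
  have "0 < c" by (simp add: c_def)
  have nd: "normal_density (x i / 2) (sqrt 3 / 2) t = c * exp (- (2 / 3) * (t - x i / 2)\<^sup>2)" for i t
    by (simp add: normal_density_def c_def power_divide field_simps)
  have prod: "(\<Prod>i<n. normal_density (x i / 2) (sqrt 3 / 2) (y i)) = c ^ n * gauss_weight n x y" for y
    by (simp add: nd prod.distrib gauss_weight_def L2_set_def sum_nonneg sum_distrib_left exp_sum)
  have "(\<integral>y. (\<Prod>i<n. normal_density (x i / 2) (sqrt 3 / 2) (y i)) \<partial>Rn_lebesgue n) = 1"
    unfolding Rn_lebesgue_def
    by (subst product_sigma_finite.product_integral_prod)
       (auto simp: product_sigma_finite_def sigma_finite_lborel)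
  then have "(\<integral>y. gauss_weight n x y \<partial>Rn_lebesgue n) = 1 / c ^ n"
    using \<open>0 < c\<close> by (simp add: prod field_simps)
  then have "gauss_weight n x y / (\<integral>z. gauss_weight n x z \<partial>Rn_lebesgue n)
      = (\<Prod>i<n. normal_density (x i / 2) (sqrt 3 / 2) (y i))" for y
    using \<open>0 < c\<close> unfolding prod by simp
  then show ?thesis
    unfolding gauss_kernel_def gauss_density_def by (simp add: prod_ennreal)
qed

lemma gauss_kernel_eq_PiM:
  "gauss_kernel n x = (\<Pi>\<^sub>M i\<in>{..<n}. normal_measure (x i / 2) (sqrt 3 / 2))"
  unfolding gauss_kernel_eq_density gauss_density_def by (rule density_Rn_lebesgue_normal) simp

lemma sets_gauss_kernel: "sets (gauss_kernel n x) = sets (Rn_space n)"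
  by (simp add: gauss_kernel_eq_density sets_Rn_lebesgue)

lemma prob_space_gauss_kernel: "prob_space (gauss_kernel n x)"
  unfolding gauss_kernel_eq_PiM by (intro prob_space_PiM prob_space_normal_measure) simp

lemma measurable_gauss_kernel: "gauss_kernel n \<in> measurable (Rn_space n) (prob_algebra (Rn_space n))"
proof (intro measurable_prob_algebraI measurable_subprob_algebra)
  fix A assume [measurable]: "A \<in> sets (Rn_space n)"
  interpret sigma_finite_measure "Rn_lebesgue n" by (rule sigma_finite_Rn_lebesgue)
  have "(\<lambda>x. \<integral>\<^sup>+y. gauss_density n x y * indicator A y \<partial>Rn_lebesgue n) \<in> borel_measurable (Rn_space n)"
    by measurable
  then show "(\<lambda>x. emeasure (gauss_kernel n x) A) \<in> borel_measurable (Rn_space n)"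
    by (rule measurable_cong[THEN iffD1, rotated])
       (simp add: gauss_kernel_eq_density emeasure_density)
qed (auto simp: prob_space_gauss_kernel sets_gauss_kernel intro: prob_space_imp_subprob_space)

lemma std_gauss_in_prob_algebra: "std_gauss n \<in> space (prob_algebra (Rn_space n))"
  unfolding space_prob_algebra std_gauss_def Rn_space_def
  by (auto intro!: prob_space_PiM prob_space_normal_measure sets_PiM_cong)

text \<open>
  The joint density of \<open>x \<sim> std_gauss n\<close> and \<open>y \<sim> gauss_kernel n x\<close> is a product over the
  coordinates of multiples of \<open>exp (- (2 / 3) * (s\<^sup>2 - s * t + t\<^sup>2))\<close>, which is symmetric in
  \<open>s\<close> and \<open>t\<close>.
\<close>

lemma gauss_detailed_balance:
  assumes f[measurable]: "f \<in> borel_measurable (Rn_space n \<Otimes>\<^sub>M Rn_space n)"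
  shows "(\<integral>\<^sup>+x. (\<integral>\<^sup>+y. f (x, y) \<partial>gauss_kernel n x) \<partial>std_gauss n)
    = (\<integral>\<^sup>+x. (\<integral>\<^sup>+y. f (y, x) \<partial>gauss_kernel n x) \<partial>std_gauss n)"
proof -
  let ?L = "Rn_lebesgue n"
  interpret L: sigma_finite_measure ?L by (rule sigma_finite_Rn_lebesgue)
  interpret LL: pair_sigma_finite ?L ?L ..
  define \<phi> where "\<phi> = (\<lambda>x::nat \<Rightarrow> real. \<Prod>i<n. ennreal (normal_density 0 1 (x i)))"
  have [measurable]: "\<phi> \<in> borel_measurable (Rn_space n)"
    unfolding \<phi>_def Rn_space_def by measurable
  have std_gauss: "std_gauss n = density ?L \<phi>"
    unfolding std_gauss_def \<phi>_def by (rule density_Rn_lebesgue_normal[symmetric]) simp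
  have sym: "\<phi> x * gauss_density n x y = \<phi> y * gauss_density n y x" for x y
  proof -
    have "normal_density 0 1 s * normal_density (s / 2) (sqrt 3 / 2) t
        = normal_density 0 1 t * normal_density (t / 2) (sqrt 3 / 2) s" for s t :: real
      by (simp add: normal_density_def power_divide power2_eq_square field_simps flip: exp_add)
    then show ?thesis
      by (simp add: \<phi>_def gauss_density_def flip: prod.distrib ennreal_mult')
  qed
  have joint: "(\<integral>\<^sup>+x. (\<integral>\<^sup>+y. g (x, y) \<partial>gauss_kernel n x) \<partial>std_gauss n)
      = (\<integral>\<^sup>+x. (\<integral>\<^sup>+y. \<phi> x * gauss_density n x y * g (x, y) \<partial>?L) \<partial>?L)"
    if [measurable]: "g \<in> borel_measurable (Rn_space n \<Otimes>\<^sub>M Rn_space n)" for g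
  proof -
    have "(\<integral>\<^sup>+x. (\<integral>\<^sup>+y. g (x, y) \<partial>gauss_kernel n x) \<partial>std_gauss n)
        = (\<integral>\<^sup>+x. (\<integral>\<^sup>+y. gauss_density n x y * g (x, y) \<partial>?L) \<partial>std_gauss n)"
    proof (rule nn_integral_cong)
      fix x assume "x \<in> space (std_gauss n)"
      then have [measurable]: "x \<in> space (Rn_space n)"
        by (simp add: std_gauss space_Rn_lebesgue)
      show "(\<integral>\<^sup>+y. g (x, y) \<partial>gauss_kernel n x) = (\<integral>\<^sup>+y. gauss_density n x y * g (x, y) \<partial>?L)"
        unfolding gauss_kernel_eq_density by (rule nn_integral_density) measurable
    qed
    also have "\<dots> = (\<integral>\<^sup>+x. \<phi> x * (\<integral>\<^sup>+y. gauss_density n x y * g (x, y) \<partial>?L) \<partial>?L)"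
      unfolding std_gauss by (rule nn_integral_density) measurable
    also have "\<dots> = (\<integral>\<^sup>+x. (\<integral>\<^sup>+y. \<phi> x * gauss_density n x y * g (x, y) \<partial>?L) \<partial>?L)"
    proof (rule nn_integral_cong)
      fix x assume "x \<in> space ?L"
      then have [measurable]: "x \<in> space (Rn_space n)"
        by (simp add: space_Rn_lebesgue)
      show "\<phi> x * (\<integral>\<^sup>+y. gauss_density n x y * g (x, y) \<partial>?L) = (\<integral>\<^sup>+y. \<phi> x * gauss_density n x y * g (x, y) \<partial>?L)"
        unfolding mult.assoc by (rule nn_integral_cmult[symmetric]) measurable
    qed
    finally show ?thesis .
  qed
  have "(\<integral>\<^sup>+x. (\<integral>\<^sup>+y. f (x, y) \<partial>gauss_kernel n x) \<partial>std_gauss n)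
      = (\<integral>\<^sup>+x. (\<integral>\<^sup>+y. \<phi> x * gauss_density n x y * f (x, y) \<partial>?L) \<partial>?L)"
    by (rule joint) fact
  also have "\<dots> = (\<integral>\<^sup>+y. (\<integral>\<^sup>+x. \<phi> x * gauss_density n x y * f (x, y) \<partial>?L) \<partial>?L)"
    by (rule LL.Fubini'[symmetric]) measurable
  also have "\<dots> = (\<integral>\<^sup>+y. (\<integral>\<^sup>+x. \<phi> y * gauss_density n y x * f (x, y) \<partial>?L) \<partial>?L)"
    by (simp only: sym)
  also have "\<dots> = (\<integral>\<^sup>+x. (\<integral>\<^sup>+y. f (y, x) \<partial>gauss_kernel n x) \<partial>std_gauss n)"
    using joint[of "\<lambda>(x, y). f (y, x)"] by simp
  finally show ?thesis .
qed

lemma measure_gauss_kernel_coordinate: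
  assumes "i < n" and S: "S \<in> sets borel"
  shows "measure (gauss_kernel n x) {y \<in> space (Rn_space n). y i \<in> S}
    = measure (normal_measure (x i / 2) (sqrt 3 / 2)) S"
proof -
  have space: "space (gauss_kernel n x) = space (Rn_space n)"
    by (rule sets_eq_imp_space_eq[OF sets_gauss_kernel])
  have "normal_measure (x i / 2) (sqrt 3 / 2)
      = distr (gauss_kernel n x) (normal_measure (x i / 2) (sqrt 3 / 2)) (\<lambda>y. y i)"
    unfolding gauss_kernel_eq_PiM
    using assms(1) by (intro distr_PiM_component[symmetric] prob_space_normal_measure) auto
  then have "measure (normal_measure (x i / 2) (sqrt 3 / 2)) S
      = measure (distr (gauss_kernel n x) (normal_measure (x i / 2) (sqrt 3 / 2)) (\<lambda>y. y i)) S"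
    by simp
  also have "\<dots> = measure (gauss_kernel n x) ((\<lambda>y. y i) -` S \<inter> space (gauss_kernel n x))"
    using assms by (intro measure_distr) (auto simp: gauss_kernel_eq_PiM)
  finally show ?thesis
    by (simp add: space vimage_def Int_def conj_commute)
qed

text \<open>
  If \<open>x i \<noteq> x' i\<close>, the next state cannot be close in coordinate \<open>i\<close> both to \<open>x i / 2\<close> and to \<open>x' i / 2\<close>. So one of
  the events "far from \<open>x i / 2\<close>" and "far from \<open>x' i / 2\<close>" must carry \<open>\<nu>\<close>-mass, whereas each of
  them is unlikely under the corresponding transition law. The constant is
  \<open>2 * (3 / 4) * 16\<close>: two events, variance \<open>3 / 4\<close>, and a threshold of a quarter of the distance.
\<close>

lemma gauss_minorization_coordinates_close:
  assumes \<nu>: "\<nu> \<in> space (prob_algebra (Rn_space n))" and i: "i < n" and \<epsilon>: "0 \<le> \<epsilon>"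
    and x: "\<And>A. A \<in> sets (Rn_space n) \<Longrightarrow> \<epsilon> * measure \<nu> A \<le> measure (gauss_kernel n x) A"
    and x': "\<And>A. A \<in> sets (Rn_space n) \<Longrightarrow> \<epsilon> * measure \<nu> A \<le> measure (gauss_kernel n x') A"
  shows "\<epsilon> * (x i - x' i)\<^sup>2 \<le> 24"
proof (cases "x i = x' i")
  case False
  interpret \<nu>: prob_space \<nu> using \<nu> by (simp add: space_prob_algebra)
  have sets_\<nu>: "sets \<nu> = sets (Rn_space n)" using \<nu> by (simp add: space_prob_algebra)
  then have space_\<nu>: "space \<nu> = space (Rn_space n)" by (rule sets_eq_imp_space_eq)
  let ?M = "Rn_space n"
  \<comment> \<open>half the distance between the two conditional means \<open>x i / 2\<close> and \<open>x' i / 2\<close>\<close>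
  define t where "t = \<bar>x i - x' i\<bar> / 4"
  have "0 < t" using False by (simp add: t_def)
  define far where "far = (\<lambda>z::nat \<Rightarrow> real. {y \<in> space ?M. y i \<in> {s. t \<le> \<bar>s - z i / 2\<bar>}})"
  have [measurable]: "far z \<in> sets ?M" for z
  proof -
    have [measurable]: "(\<lambda>y. y i) \<in> borel_measurable ?M"
      unfolding Rn_space_def by (rule measurable_component_singleton) (use i in simp)
    show ?thesis unfolding far_def mem_Collect_eq by measurable
  qed
  have tail: "measure (gauss_kernel n z) (far z) \<le> (3 / 4) / t\<^sup>2" for z
    unfolding far_def using normal_measure_tail[of "sqrt 3 / 2" t "z i / 2"] i \<open>0 < t\<close>
    by (subst measure_gauss_kernel_coordinate) (auto simp: power_divide)
  have "space \<nu> \<subseteq> far x \<union> far x'"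
  proof
    fix y assume y: "y \<in> space \<nu>"
    have "4 * t \<le> 2 * \<bar>y i - x i / 2\<bar> + 2 * \<bar>y i - x' i / 2\<bar>"
      using abs_triangle_ineq4[of "y i - x' i / 2" "y i - x i / 2"] by (simp add: t_def field_simps)
    moreover have "t \<le> u \<or> t \<le> v" if "4 * t \<le> 2 * u + 2 * v" for u v
      using that by linarith
    ultimately have "t \<le> \<bar>y i - x i / 2\<bar> \<or> t \<le> \<bar>y i - x' i / 2\<bar>" by blast
    then show "y \<in> far x \<union> far x'" using y by (auto simp: far_def space_\<nu>)
  qed
  then have "1 \<le> measure \<nu> (far x) + measure \<nu> (far x')"
    using \<nu>.finite_measure_mono[of "space \<nu>" "far x \<union> far x'"] measure_Un_le[of "far x" \<nu> "far x'"]
    by (simp add: sets_\<nu> \<nu>.prob_space)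
  then have "\<epsilon> * 1 \<le> \<epsilon> * (measure \<nu> (far x) + measure \<nu> (far x'))"
    by (rule mult_left_mono) fact
  also have "\<dots> = \<epsilon> * measure \<nu> (far x) + \<epsilon> * measure \<nu> (far x')"
    by (rule distrib_left)
  also have "\<dots> \<le> (3 / 4) / t\<^sup>2 + (3 / 4) / t\<^sup>2"
    by (intro add_mono order_trans[OF x tail] order_trans[OF x' tail]) measurable
  finally have "\<epsilon> \<le> 2 * ((3 / 4) / t\<^sup>2)" by simp
  then show ?thesis
    using \<open>0 < t\<close> by (simp add: t_def power_divide field_simps)
qed simp

lemma std_gauss_box_le:
  assumes C: "C \<in> sets (Rn_space n)" and box: "\<And>x i. x \<in> C \<Longrightarrow> i < n \<Longrightarrow> \<bar>x i - a i\<bar> \<le> D"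
    and q: "\<And>a. measure (normal_measure 0 1) {a - D..a + D} \<le> q"
  shows "measure (std_gauss n) C \<le> q ^ n"
proof -
  interpret N: prob_space "normal_measure 0 1" by (rule prob_space_normal_measure) simp
  interpret G: prob_space "std_gauss n" using std_gauss_in_prob_algebra by (simp add: space_prob_algebra)
  have "0 \<le> q" using q[of 0] by (meson measure_nonneg order_trans)
  have "C \<subseteq> (\<Pi>\<^sub>E i\<in>{..<n}. {a i - D..a i + D})"
  proof
    fix x assume x: "x \<in> C"
    have "x i \<in> {a i - D..a i + D}" if "i < n" for i
      using box[OF x that] by (auto simp: abs_le_iff)
    moreover have "x \<in> extensional {..<n}"
      using x sets.sets_into_space[OF C] by (auto simp: Rn_space_def space_PiM PiE_iff)
    ultimately show "x \<in> (\<Pi>\<^sub>E i\<in>{..<n}. {a i - D..a i + D})"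
      by (auto simp: PiE_iff)
  qed
  then have "emeasure (std_gauss n) C \<le> emeasure (std_gauss n) (\<Pi>\<^sub>E i\<in>{..<n}. {a i - D..a i + D})"
    by (intro emeasure_mono) (auto simp: std_gauss_def intro!: sets_PiM_I_finite)
  also have "\<dots> = (\<Prod>i<n. emeasure (normal_measure 0 1) {a i - D..a i + D})"
    unfolding std_gauss_def
    by (intro product_sigma_finite.emeasure_PiM) (auto simp: product_sigma_finite_def N.sigma_finite_measure_axioms)
  also have "\<dots> = ennreal (\<Prod>i<n. measure (normal_measure 0 1) {a i - D..a i + D})"
    by (simp add: N.emeasure_eq_measure prod_ennreal)
  also have "\<dots> \<le> ennreal (\<Prod>i<n. q)"
    by (intro ennreal_leI prod_mono) (auto simp: q)
  finally show ?thesis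
    using \<open>0 \<le> q\<close> by (simp add: G.emeasure_eq_measure)
qed

text \<open>
  The base \<open>q\<close> depends on \<open>\<delta>\<close> only, so for a fixed \<open>\<delta>\<close> the drift factors that occur together
  with some \<open>\<epsilon> \<ge> \<delta>\<close> tend to 1 uniformly as \<open>n\<close> grows.
\<close>

lemma gauss_drift_factor_lower_bound:
  assumes "0 < \<delta>"
  obtains q where "0 \<le> q" "q < 1"
    "\<And>n l K \<epsilon> \<beta>. (l, K, \<epsilon>, \<beta>) \<in> dm_params_of (Rn_space n) (gauss_kernel n) \<Longrightarrow> \<delta> \<le> \<epsilon> \<Longrightarrow> 1 - 2 * q ^ n \<le> l"
proof -
  define D where "D = sqrt (24 / \<delta>)"
  obtain q where q: "0 \<le> q" "q < 1" "\<And>a. measure (normal_measure 0 1) {a - D..a + D} \<le> q"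
    using standard_normal_intervals_bounded_away_from_1[of D] by blast
  have "1 - 2 * q ^ n \<le> l"
    if \<theta>: "(l, K, \<epsilon>, \<beta>) \<in> dm_params_of (Rn_space n) (gauss_kernel n)" and "\<delta> \<le> \<epsilon>" for n l K \<epsilon> \<beta>
  proof -
    let ?M = "Rn_space n"
    have params: "0 \<le> l" "0 < \<epsilon>" "0 < \<beta>" and "satisfies_dm ?M (gauss_kernel n) (l, K, \<epsilon>, \<beta>)"
      using \<theta> by (auto simp: dm_params_of_def dm_params_def)
    then obtain C V \<nu> where C: "C \<in> sets ?M" and V: "V \<in> borel_measurable ?M" "\<And>x. x \<in> space ?M \<Longrightarrow> 1 \<le> V x"
      and \<nu>: "\<nu> \<in> space (prob_algebra ?M)"
      and drift: "\<And>x. x \<in> space ?M \<Longrightarrow> (\<integral>\<^sup>+y. ennreal (V y) \<partial>gauss_kernel n x)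
            \<le> ennreal (l * V x * indicator (space ?M - C) x + K * indicator C x)"
      and minor: "\<And>x A. x \<in> C \<Longrightarrow> A \<in> sets ?M \<Longrightarrow> \<epsilon> * measure \<nu> A \<le> measure (gauss_kernel n x) A"
      and \<nu>C: "\<beta> \<le> measure \<nu> C"
      by auto
    have "C \<noteq> {}" using \<nu>C \<open>0 < \<beta>\<close> by auto
    then obtain a where a: "a \<in> C" by auto
    have "\<bar>x i - a i\<bar> \<le> D" if "x \<in> C" "i < n" for x i
    proof -
      have "\<epsilon> * (x i - a i)\<^sup>2 \<le> 24"
        using that a params by (intro gauss_minorization_coordinates_close[OF \<nu>] minor) auto
      moreover have "\<delta> * (x i - a i)\<^sup>2 \<le> \<epsilon> * (x i - a i)\<^sup>2"
        using \<open>\<delta> \<le> \<epsilon>\<close> by (intro mult_right_mono) auto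
      ultimately have "(x i - a i)\<^sup>2 \<le> 24 / \<delta>"
        using \<open>0 < \<delta>\<close> by (simp add: field_simps)
      then show ?thesis
        unfolding D_def by (metis real_sqrt_abs real_sqrt_le_mono)
    qed
    then have "measure (std_gauss n) C \<le> q ^ n"
      by (rule std_gauss_box_le[OF C]) (auto intro: q)
    moreover have "1 - 2 * measure (std_gauss n) C \<le> l"
    proof (rule reversible_drift_factor_lower_bound[OF std_gauss_in_prob_algebra measurable_gauss_kernel
          gauss_detailed_balance C V(1)])
      show "0 < V x" if "x \<in> space ?M" for x
        using V(2)[OF that] by linarith
      show "(\<integral>\<^sup>+y. ennreal (V y) \<partial>gauss_kernel n x) \<le> ennreal (l * V x)" if "x \<in> space ?M - C" for x
        using drift[of x] that by simp
    qed (use params in auto)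
    ultimately show ?thesis by linarith
  qed
  then show ?thesis using that q(1,2) by blast
qed

section \<open>The Gaussian chain in high dimension\<close>

theorem proposition10:
  fixes \<iota> :: "int \<Rightarrow> 's" and U :: "'s measure set"
  assumes "inj \<iota>"
    and "\<And>F. finite F \<Longrightarrow> \<exists>N\<in>U. sets N = Pow (\<iota> ` F)"
  shows "(\<lambda>n. rho_opt_chain U (Rn_space n) (gauss_kernel n)) \<longlonglongrightarrow> 1"
proof (rule order_tendstoI)
  fix c :: ereal assume "1 < c"
  then show "\<forall>\<^sub>F n in sequentially. rho_opt_chain U (Rn_space n) (gauss_kernel n) < c"
    using rho_opt_chain_le_1 by (intro always_eventually allI) (rule le_less_trans)
next
  fix c :: ereal assume "c < 1"
  then have "max c 0 < 1" by simp
  then obtain r where r: "max c 0 < ereal r" "ereal r < 1"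
    using ereal_dense2 by blast
  then have "c < ereal r" "0 < r" "r < 1" by (simp_all add: zero_ereal_def one_ereal_def)
  obtain q where q: "0 \<le> q" "q < 1"
    "\<And>n l K \<epsilon> \<beta>. (l, K, \<epsilon>, \<beta>) \<in> dm_params_of (Rn_space n) (gauss_kernel n) \<Longrightarrow> 1 - r \<le> \<epsilon> \<Longrightarrow> 1 - 2 * q ^ n \<le> l"
    using gauss_drift_factor_lower_bound[of "1 - r"] \<open>r < 1\<close> by auto
  obtain N where N: "N \<in> U" "sets N = Pow {\<iota> 0, \<iota> 1}"
    using assms(2)[of "{0, 1}"] by auto
  have "\<iota> 0 \<noteq> \<iota> 1"
    using assms(1) by (simp add: inj_eq)
  have "(\<lambda>n. 1 - 2 * q ^ n) \<longlonglongrightarrow> 1 - 2 * 0"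
    using q by (intro tendsto_intros LIMSEQ_realpow_zero)
  then have "\<forall>\<^sub>F n in sequentially. r < 1 - 2 * q ^ n"
    using \<open>r < 1\<close> by (intro order_tendstoD) auto
  then show "\<forall>\<^sub>F n in sequentially. c < rho_opt_chain U (Rn_space n) (gauss_kernel n)"
  proof eventually_elim
    fix n assume n: "r < 1 - 2 * q ^ n"
    have "ereal r \<le> rho_opt_nonneg U \<theta>" if \<theta>: "\<theta> \<in> dm_params_of (Rn_space n) (gauss_kernel n)" for \<theta>
    proof -
      obtain l K \<epsilon> \<beta> where \<theta>_eq: "\<theta> = (l, K, \<epsilon>, \<beta>)" by (cases \<theta>) auto
      \<comment> \<open>a minorization constant above \<open>1 - r\<close> forces the drift factor beyond \<open>r\<close>\<close>
      have "r < l \<or> r \<le> 1 - \<epsilon>"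
        using q(3)[of l K \<epsilon> \<beta> n] \<theta> n unfolding \<theta>_eq by linarith
      then show ?thesis
        using \<theta> unfolding \<theta>_eq
        by (intro rho_opt_nonneg_lower_bound[OF N \<open>\<iota> 0 \<noteq> \<iota> 1\<close> \<open>0 < r\<close> \<open>r < 1\<close>]) (auto simp: dm_params_of_def)
    qed
    then have "ereal r \<le> rho_opt_chain U (Rn_space n) (gauss_kernel n)"
      using r(2) by (auto simp: rho_opt_chain_def intro: INF_greatest)
    with \<open>c < ereal r\<close> show "c < rho_opt_chain U (Rn_space n) (gauss_kernel n)"
      by (rule less_le_trans)
  qed
qed

end
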